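(* There exists a smooth Banach space $X$ whose dual map $\mathsf{J}_X : X \to X^*$ fails to be $w$-$w$ continuous at $0$.
   Context: $\mathsf{B}_X$ and $\mathsf{S}_X$ denote the closed unit ball and the unit sphere of a Banach space $X$, and $X^*$ is the (continuous) dual. A point $x \in \mathsf{S}_X$ is a smooth point of $\mathsf{B}_X$ if there is exactly one $f \in \mathsf{S}_{X^*}$ attaining its norm at $x$, i.e. with $f(x) = 1$. $X$ is smooth if every point of $\mathsf{S}_X$ is a smooth point of $\mathsf{B}_X$. If $X$ is smooth, its dual map is the unique map $\mathsf{J}_X : X \to X^*$ with $\|\mathsf{J}_X(x)\| = \|x\|$ and $\mathsf{J}_X(x)(x) = \|x\|^2$ for all $x \in X$. "$w$-$w$ continuous at $0$" means continuous at $0$ as a map from $X$ with its weak topology to $X^*$ with its weak topology $\sigma(X^*, X^{**})$. *)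

theory Defs
  imports "HOL-Analysis.Analysis" "HOL-Library.Function_Algebras"
begin

instantiation "fun" :: (type, real_vector) real_vector
begin

definition scaleR_fun :: "real \<Rightarrow> ('a \<Rightarrow> 'b) \<Rightarrow> 'a \<Rightarrow> 'b"
  where "scaleR_fun c f = (\<lambda>x. c *\<^sub>R f x)"

instance
  by standard (simp_all add: scaleR_fun_def fun_eq_iff scaleR_add_right scaleR_add_left)

end

lemma scaleR_fun_apply [simp]: "(c *\<^sub>R f) x = c *\<^sub>R f x"
  by (simp add: scaleR_fun_def)

text \<open>A type class such as \<^class>\<open>banach\<close> does not allow one to quantify existentially over
  Banach spaces. Here a (real) normed space is a linear subspace of an ambient real vector space,
  together with a norm on that subspace; the values of \<open>nrm\<close> elsewhere are irrelevant, and
  the ambient space carries no topology.\<close>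

record 'a nspace =
  points :: "'a set"
  nrm :: "'a \<Rightarrow> real"

definition normed_space :: "'a::real_vector nspace \<Rightarrow> bool"
  where "normed_space X \<longleftrightarrow> subspace (points X) \<and>
    (\<forall>x\<in>points X. 0 \<le> nrm X x) \<and>
    (\<forall>x\<in>points X. nrm X x = 0 \<longleftrightarrow> x = 0) \<and>
    (\<forall>c. \<forall>x\<in>points X. nrm X (c *\<^sub>R x) = \<bar>c\<bar> * nrm X x) \<and>
    (\<forall>x\<in>points X. \<forall>y\<in>points X. nrm X (x + y) \<le> nrm X x + nrm X y)"

text \<open>The distance is set to 0 outside the space because the locale \<^locale>\<open>Metric_space\<close>
  requires nonnegativity and symmetry on the whole type.\<close>

definition ndist :: "'a::real_vector nspace \<Rightarrow> 'a \<Rightarrow> 'a \<Rightarrow> real"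
  where "ndist X x y = (if x \<in> points X \<and> y \<in> points X then nrm X (x - y) else 0)"

definition banach_space :: "'a::real_vector nspace \<Rightarrow> bool"
  where "banach_space X \<longleftrightarrow> normed_space X \<and> Metric_space.mcomplete (points X) (ndist X)"

definition unit_ball :: "'a::real_vector nspace \<Rightarrow> 'a set"
  where "unit_ball X = {x \<in> points X. nrm X x \<le> 1}"

definition unit_sphere :: "'a::real_vector nspace \<Rightarrow> 'a set"
  where "unit_sphere X = {x \<in> points X. nrm X x = 1}"

text \<open>A functional on \<open>X\<close> is represented by its extension by 0 to the ambient space, so that
  distinct elements of \<open>dual_space X\<close> are distinct as functionals on \<open>X\<close>.\<close>

definition dual_space :: "'a::real_vector nspace \<Rightarrow> ('a \<Rightarrow> real) nspace"
  where "dual_space X =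
    \<lparr>points = {f. (\<forall>x\<in>points X. \<forall>y\<in>points X. f (x + y) = f x + f y) \<and>
                (\<forall>c. \<forall>x\<in>points X. f (c *\<^sub>R x) = c * f x) \<and>
                (\<exists>C. \<forall>x\<in>points X. \<bar>f x\<bar> \<le> C * nrm X x) \<and>
                (\<forall>x. x \<notin> points X \<longrightarrow> f x = 0)},
     nrm = (\<lambda>f. SUP x\<in>unit_ball X. \<bar>f x\<bar>)\<rparr>"

definition smooth_point :: "'a::real_vector nspace \<Rightarrow> 'a \<Rightarrow> bool"
  where "smooth_point X x \<longleftrightarrow>
    x \<in> unit_sphere X \<and> (\<exists>!f. f \<in> unit_sphere (dual_space X) \<and> f x = 1)"

definition smooth_space :: "'a::real_vector nspace \<Rightarrow> bool"
  where "smooth_space X \<longleftrightarrow> (\<forall>x\<in>unit_sphere X. smooth_point X x)"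

text \<open>Well-defined on smooth spaces; see \<open>dual_map\<close> and \<open>dual_map_unique\<close> below.\<close>

definition dual_map :: "'a::real_vector nspace \<Rightarrow> 'a \<Rightarrow> 'a \<Rightarrow> real"
  where "dual_map X x = (THE f. f \<in> points (dual_space X) \<and>
    nrm (dual_space X) f = nrm X x \<and> f x = (nrm X x)\<^sup>2)"

text \<open>The coarsest topology on \<open>X\<close> making every element of the dual continuous. In particular,
  \<open>weak_topology (dual_space X)\<close> is the topology induced on the dual by the bidual.\<close>

definition weak_topology :: "'a::real_vector nspace \<Rightarrow> 'a topology"
  where "weak_topology X = topology_generated_by
    {{x \<in> points X. f x \<in> U} | f U. f \<in> points (dual_space X) \<and> open U}"

lemma topspace_weak_topology: "topspace (weak_topology X) = points X"
proof -
  have "(\<lambda>x. 0) \<in> points (dual_space X)"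
    by (auto simp: dual_space_def intro!: exI[of _ 0])
  then have "points X \<in> {{x \<in> points X. f x \<in> U} | f U. f \<in> points (dual_space X) \<and> open U}"
    by (force intro: exI[of _ UNIV])
  then show ?thesis
    by (auto simp: weak_topology_def)
qed

lemma Metric_space_ndist:
  assumes "normed_space X"
  shows "Metric_space (points X) (ndist X)"
proof
  have sub: "subspace (points X)" and sc: "\<And>c x. x \<in> points X \<Longrightarrow> nrm X (c *\<^sub>R x) = \<bar>c\<bar> * nrm X x"
    and tri: "\<And>x y. x \<in> points X \<Longrightarrow> y \<in> points X \<Longrightarrow> nrm X (x + y) \<le> nrm X x + nrm X y"
    and z: "\<And>x. x \<in> points X \<Longrightarrow> nrm X x = 0 \<longleftrightarrow> x = 0"
    and nn: "\<And>x. x \<in> points X \<Longrightarrow> 0 \<le> nrm X x"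
    using assms by (auto simp: normed_space_def)
  note d = subspace_diff[OF sub]
  show "0 \<le> ndist X x y" for x y
    by (simp add: ndist_def nn d)
  show "ndist X x y = ndist X y x" for x y
    using sc[of "x - y" "-1"] d[of x y] by (auto simp: ndist_def)
  show "ndist X x y = 0 \<longleftrightarrow> x = y" if "x \<in> points X" "y \<in> points X" for x y
    using that by (simp add: ndist_def z d)
  show "ndist X x t \<le> ndist X x y + ndist X y t"
    if "x \<in> points X" "y \<in> points X" "t \<in> points X" for x y t
    using that tri[of "x - y" "y - t"] by (simp add: ndist_def d)
qed

lemma bdd_above_dual:
  assumes "normed_space X" "f \<in> points (dual_space X)"
  shows "bdd_above ((\<lambda>x. \<bar>f x\<bar>) ` unit_ball X)"
proof -
  obtain C where C: "\<And>x. x \<in> points X \<Longrightarrow> \<bar>f x\<bar> \<le> C * nrm X x"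
    using assms(2) unfolding dual_space_def nspace.simps mem_Collect_eq by blast
  have "\<bar>f x\<bar> \<le> \<bar>C\<bar>" if "x \<in> unit_ball X" for x
  proof -
    have x: "x \<in> points X" "nrm X x \<le> 1" "0 \<le> nrm X x"
      using that assms(1) by (auto simp: unit_ball_def normed_space_def)
    have "C * nrm X x \<le> \<bar>C\<bar> * nrm X x"
      using x by (simp add: mult_right_mono)
    also have "\<dots> \<le> \<bar>C\<bar>"
      using x by (simp add: mult_left_le)
    finally show ?thesis
      using C[OF x(1)] by linarith
  qed
  then show ?thesis
    by (auto intro!: bdd_aboveI[of _ "\<bar>C\<bar>"])
qed

lemma zero_in_unit_ball: "normed_space X \<Longrightarrow> 0 \<in> unit_ball X"
  using subspace_0 by (fastforce simp: normed_space_def unit_ball_def)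

lemma dual_bound:
  assumes "normed_space X" "f \<in> points (dual_space X)" "x \<in> points X"
  shows "\<bar>f x\<bar> \<le> nrm (dual_space X) f * nrm X x"
proof (cases "x = 0")
  case True
  have "\<forall>c. \<forall>x\<in>points X. f (c *\<^sub>R x) = c * f x"
    using assms(2) by (simp add: dual_space_def)
  then have "f (0 *\<^sub>R x) = 0 * f x"
    using assms(3) by blast
  moreover have "nrm X x = 0"
    using True assms(1,3) unfolding normed_space_def by blast
  ultimately show ?thesis
    using True by simp
next
  case False
  then have p: "nrm X x > 0"
    using assms by (force simp: normed_space_def less_le)
  let ?y = "inverse (nrm X x) *\<^sub>R x"
  have "?y \<in> unit_ball X"
    using assms p by (auto simp: normed_space_def unit_ball_def subspace_scale)
  then have "\<bar>f ?y\<bar> \<le> nrm (dual_space X) f"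
    using cSUP_upper[OF _ bdd_above_dual[OF assms(1,2)]] by (simp add: dual_space_def)
  moreover have "f ?y = inverse (nrm X x) * f x"
    using assms(2,3) by (simp add: dual_space_def)
  ultimately have "inverse (nrm X x) * \<bar>f x\<bar> \<le> nrm (dual_space X) f"
    using p by (simp add: abs_mult)
  then show ?thesis
    using p by (simp add: field_simps)
qed

lemma normed_space_dual:
  assumes X: "normed_space X"
  shows "normed_space (dual_space X)"
proof -
  let ?D = "dual_space X"
  have ne: "unit_ball X \<noteq> {}"
    using zero_in_unit_ball[OF X] by auto
  have nrm: "nrm ?D f = (SUP x\<in>unit_ball X. \<bar>f x\<bar>)" for f
    by (simp add: dual_space_def)
  have up: "\<bar>f x\<bar> \<le> nrm ?D f" if "f \<in> points ?D" "x \<in> unit_ball X" for f x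
    unfolding nrm using that bdd_above_dual[OF X that(1)] by (intro cSUP_upper)
  have least: "nrm ?D f \<le> M" if "\<And>x. x \<in> unit_ball X \<Longrightarrow> \<bar>f x\<bar> \<le> M" for f M
    unfolding nrm using that ne by (intro cSUP_least)
  have nn: "0 \<le> nrm ?D f" if "f \<in> points ?D" for f
    using up[OF that zero_in_unit_ball[OF X]] by linarith
  have sub: "subspace (points ?D)"
  proof (rule subspaceI)
    show "0 \<in> points ?D"
      by (auto simp: dual_space_def intro!: exI[of _ 0])
  next
    fix f g assume fg: "f \<in> points ?D" "g \<in> points ?D"
    have "\<exists>C. \<forall>x\<in>points X. \<bar>f x + g x\<bar> \<le> C * nrm X x"
    proof (intro exI ballI)
      fix x assume "x \<in> points X"
      then show "\<bar>f x + g x\<bar> \<le> (nrm ?D f + nrm ?D g) * nrm X x"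
        using dual_bound[OF X fg(1), of x] dual_bound[OF X fg(2), of x]
        by (simp add: distrib_right abs_le_iff)
    qed
    then show "f + g \<in> points ?D"
      using fg by (simp add: dual_space_def algebra_simps)
  next
    fix c f assume f: "f \<in> points ?D"
    have "\<exists>C. \<forall>x\<in>points X. \<bar>c * f x\<bar> \<le> C * nrm X x"
    proof (intro exI ballI)
      fix x assume "x \<in> points X"
      then show "\<bar>c * f x\<bar> \<le> (\<bar>c\<bar> * nrm ?D f) * nrm X x"
        using dual_bound[OF X f, of x] by (simp add: abs_mult mult.assoc mult_left_mono)
    qed
    then show "c *\<^sub>R f \<in> points ?D"
      using f by (simp add: dual_space_def algebra_simps)
  qed
  have le: "nrm ?D (c *\<^sub>R f) \<le> \<bar>c\<bar> * nrm ?D f" if "f \<in> points ?D" for c f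
    using up[OF that] by (intro least) (simp add: abs_mult mult_left_mono)
  have "nrm ?D (c *\<^sub>R f) = \<bar>c\<bar> * nrm ?D f" if f: "f \<in> points ?D" for c f
  proof (cases "c = 0")
    case True
    then show ?thesis
      using le[OF f, of c] nn[OF subspace_scale[OF sub f], of c] by simp
  next
    case False
    have "nrm ?D f \<le> \<bar>inverse c\<bar> * nrm ?D (c *\<^sub>R f)"
      using le[OF subspace_scale[OF sub f], of "inverse c" c] False by simp
    then show ?thesis
      using le[OF f, of c] False by (simp add: field_simps abs_inverse)
  qed
  moreover have "nrm ?D f = 0 \<longleftrightarrow> f = 0" if f: "f \<in> points ?D" for f
  proof
    assume "nrm ?D f = 0"
    then have "f x = 0" if "x \<in> points X" for x
      using dual_bound[OF X f that] by simp
    then show "f = 0"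
      using f by (fastforce simp: dual_space_def)
  next
    assume "f = 0"
    then show "nrm ?D f = 0"
      using le[OF f, of 0] nn[OF f] by simp
  qed
  moreover have "nrm ?D (f + g) \<le> nrm ?D f + nrm ?D g"
    if f: "f \<in> points ?D" and g: "g \<in> points ?D" for f g
  proof (rule least)
    fix x assume "x \<in> unit_ball X"
    then show "\<bar>(f + g) x\<bar> \<le> nrm ?D f + nrm ?D g"
      using up[OF f, of x] up[OF g, of x] by simp
  qed
  ultimately show ?thesis
    using sub nn by (simp add: normed_space_def)
qed

lemma dual_map_ex1:
  assumes X: "normed_space X" and sm: "smooth_space X" and x: "x \<in> points X"
  shows "\<exists>!f. f \<in> points (dual_space X) \<and>
    nrm (dual_space X) f = nrm X x \<and> f x = (nrm X x)\<^sup>2"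
proof -
  let ?D = "dual_space X"
  have D: "normed_space ?D"
    by (rule normed_space_dual[OF X])
  have subD: "subspace (points ?D)"
    and scD: "\<And>c f. f \<in> points ?D \<Longrightarrow> nrm ?D (c *\<^sub>R f) = \<bar>c\<bar> * nrm ?D f"
    and zD: "\<And>f. f \<in> points ?D \<Longrightarrow> nrm ?D f = 0 \<longleftrightarrow> f = 0"
    using D by (auto simp: normed_space_def)
  show ?thesis
  proof (cases "x = 0")
    case True
    then have "nrm X x = 0"
      using X x by (simp add: normed_space_def)
    then show ?thesis
      using zD subspace_0[OF subD] by (auto intro!: ex1I[of _ 0])
  next
    case False
    define r where "r = nrm X x"
    have r: "r > 0"
      using X x False by (force simp: normed_space_def less_le r_def)
    define u where "u = inverse r *\<^sub>R x"
    have u: "u \<in> unit_sphere X"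
      using X x r by (simp add: normed_space_def unit_sphere_def u_def subspace_scale flip: r_def)
    have fu: "f u = inverse r * f x" if "f \<in> points ?D" for f
      using that x by (simp add: u_def dual_space_def)
    obtain g where g: "g \<in> points ?D" "nrm ?D g = 1" "g u = 1"
      and uniq: "\<And>h. h \<in> points ?D \<Longrightarrow> nrm ?D h = 1 \<Longrightarrow> h u = 1 \<Longrightarrow> h = g"
      using sm u unfolding smooth_space_def smooth_point_def unit_sphere_def[of ?D] by blast
    show ?thesis
    proof (rule ex1I[of _ "r *\<^sub>R g"])
      have "g x = r"
        using fu[OF g(1)] g(3) r by (simp add: field_simps)
      then show "r *\<^sub>R g \<in> points ?D \<and> nrm ?D (r *\<^sub>R g) = nrm X x \<and> (r *\<^sub>R g) x = (nrm X x)\<^sup>2"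
        using g scD subspace_scale[OF subD] r by (simp add: power2_eq_square flip: r_def)
    next
      fix f assume f: "f \<in> points ?D \<and> nrm ?D f = nrm X x \<and> f x = (nrm X x)\<^sup>2"
      have "f u = r"
        using f r fu[of f] by (simp add: power2_eq_square flip: r_def)
      then have "inverse r *\<^sub>R f = g"
        using f r scD subspace_scale[OF subD]
        by (intro uniq) (simp_all flip: r_def)
      then show "f = r *\<^sub>R g"
        using r by auto
    qed
  qed
qed

lemma dual_map:
  assumes "normed_space X" "smooth_space X" "x \<in> points X"
  shows "dual_map X x \<in> points (dual_space X)"
    and "nrm (dual_space X) (dual_map X x) = nrm X x"
    and "dual_map X x x = (nrm X x)\<^sup>2"
  using theI'[OF dual_map_ex1[OF assms]] by (simp_all add: dual_map_def)

lemma dual_map_unique: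
  assumes "normed_space X" "smooth_space X" "x \<in> points X"
    and "f \<in> points (dual_space X)" "nrm (dual_space X) f = nrm X x" "f x = (nrm X x)\<^sup>2"
  shows "dual_map X x = f"
  unfolding dual_map_def using assms dual_map_ex1[OF assms(1-3)]
  by (intro the1_equality) auto

end

theory Submission
  imports Defs
begin

text \<open>The space is \<open>\<ell>\<^sub>4\<close>, whose norm is smooth because its fourth power is a polynomial along
  every line: if a norm-one functional \<open>f\<close> attains its norm at a unit vector \<open>x\<close>, then the
  polynomial \<open>t \<mapsto> (\<Sum>n. (x n + t * y n)^4) - (1 + t * f y)^4\<close> is nonnegative and vanishes at
  \<open>t = 0\<close>, so its derivative \<open>4 * ((\<Sum>n. x n ^ 3 * y n) - f y)\<close> is zero there and \<open>f\<close> is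
  determined (\<open>l4_support_unique\<close>). Conversely Young's inequality shows that
  \<open>y \<mapsto> \<Sum>n. x n ^ 3 * y n\<close> is such a functional.

  The dual map is discontinuous already along multiples of the unit vectors \<open>e\<^sub>n\<close>, where it is
  simply \<open>t e\<^sub>n \<mapsto> t e\<^sub>n\<^sup>*\<close>. Put \<open>z n = (n + 1) powr (-1/2)\<close>, which lies in \<open>\<ell>\<^sub>4\<close> but not in the
  dual \<open>\<ell>\<^bsub>4/3\<^esub>\<close>. For finitely many functionals \<open>f\<close> on \<open>\<ell>\<^sub>4\<close>, the sum of the \<open>\<bar>f e\<^sub>n\<bar>\<close> cannot
  dominate a positive multiple of \<open>z n\<close> for all \<open>n\<close>, since pairing with \<open>z\<close> would bound the
  harmonic series (\<open>dual_coefficients_below\<close>). Hence every weak neighbourhood of \<open>0\<close>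
  contains some \<open>(2 / z n) e\<^sub>n\<close>, whereas the dual map sends this vector to a functional with value
  \<open>2\<close> at \<open>z\<close>. Evaluation at \<open>z\<close> belongs to the bidual, so continuity at \<open>0\<close> fails.\<close>


section \<open>Functionals and weak neighbourhoods\<close>

lemma dual_spaceI:
  assumes "\<And>x y. x \<in> points X \<Longrightarrow> y \<in> points X \<Longrightarrow> f (x + y) = f x + f y"
    and "\<And>c x. x \<in> points X \<Longrightarrow> f (c *\<^sub>R x) = c * f x"
    and "\<And>x. x \<in> points X \<Longrightarrow> \<bar>f x\<bar> \<le> C * nrm X x"
    and "\<And>x. x \<notin> points X \<Longrightarrow> f x = 0"
  shows "f \<in> points (dual_space X)"
  unfolding dual_space_def nspace.simps mem_Collect_eq using assms by (intro conjI) blast+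

lemma dual_spaceD:
  assumes "f \<in> points (dual_space X)"
  shows "\<And>x y. x \<in> points X \<Longrightarrow> y \<in> points X \<Longrightarrow> f (x + y) = f x + f y"
    and "\<And>c x. x \<in> points X \<Longrightarrow> f (c *\<^sub>R x) = c * f x"
    and "\<And>x. x \<notin> points X \<Longrightarrow> f x = 0"
  using assms unfolding dual_space_def by auto

lemma normed_spaceD:
  assumes "normed_space X"
  shows "subspace (points X)"
    and "\<And>x. x \<in> points X \<Longrightarrow> 0 \<le> nrm X x"
    and "\<And>x. x \<in> points X \<Longrightarrow> nrm X x = 0 \<longleftrightarrow> x = 0"
    and "\<And>c x. x \<in> points X \<Longrightarrow> nrm X (c *\<^sub>R x) = \<bar>c\<bar> * nrm X x"
    and "\<And>x y. x \<in> points X \<Longrightarrow> y \<in> points X \<Longrightarrow> nrm X (x + y) \<le> nrm X x + nrm X y"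
  using assms unfolding normed_space_def by auto

lemma dual_zero:
  assumes "normed_space X" "f \<in> points (dual_space X)"
  shows "f 0 = 0"
  using dual_spaceD(2)[OF assms(2), of 0 0] subspace_0[OF normed_spaceD(1)[OF assms(1)]] by simp

lemma dual_norm_eqI:
  assumes X: "normed_space X" and f: "f \<in> points (dual_space X)"
    and le: "\<And>y. y \<in> points X \<Longrightarrow> \<bar>f y\<bar> \<le> M * nrm X y"
    and x: "x \<in> points X" "x \<noteq> 0" and fx: "\<bar>f x\<bar> = M * nrm X x"
  shows "nrm (dual_space X) f = M"
proof (rule antisym)
  have pos: "nrm X x > 0"
    using normed_spaceD(2,3)[OF X x(1)] x(2) by linarith
  have "M * nrm X x \<ge> 0"
    using fx by (metis abs_ge_zero)
  then have M: "M \<ge> 0"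
    using pos by (simp add: zero_le_mult_iff)
  have "(SUP x\<in>unit_ball X. \<bar>f x\<bar>) \<le> M"
  proof (rule cSUP_least)
    show "unit_ball X \<noteq> {}"
      using zero_in_unit_ball[OF X] by auto
    fix y assume "y \<in> unit_ball X"
    then have y: "y \<in> points X" "nrm X y \<le> 1"
      by (auto simp: unit_ball_def)
    show "\<bar>f y\<bar> \<le> M"
      using le[OF y(1)] mult_left_le[OF y(2) M] by linarith
  qed
  then show "nrm (dual_space X) f \<le> M"
    by (simp add: dual_space_def)
  show "M \<le> nrm (dual_space X) f"
    using dual_bound[OF X f x(1)] fx pos by simp
qed

text \<open>The canonical image of \<open>z\<close> in the bidual, extended by 0 outside the dual as membership in
  \<^const>\<open>dual_space\<close> demands.\<close>

definition evaluation :: "'a::real_vector nspace \<Rightarrow> 'a \<Rightarrow> ('a \<Rightarrow> real) \<Rightarrow> real"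
  where "evaluation X z g = (if g \<in> points (dual_space X) then g z else 0)"

lemma evaluation_in_bidual:
  assumes X: "normed_space X" and z: "z \<in> points X"
  shows "evaluation X z \<in> points (dual_space (dual_space X))"
proof (rule dual_spaceI)
  note sub = normed_spaceD(1)[OF normed_space_dual[OF X]]
  show "evaluation X z (f + g) = evaluation X z f + evaluation X z g"
    if "f \<in> points (dual_space X)" "g \<in> points (dual_space X)" for f g
    using that subspace_add[OF sub that] by (simp add: evaluation_def)
  show "evaluation X z (c *\<^sub>R f) = c * evaluation X z f" if "f \<in> points (dual_space X)" for c f
    using that subspace_scale[OF sub that] by (simp add: evaluation_def)
  show "\<bar>evaluation X z f\<bar> \<le> nrm X z * nrm (dual_space X) f"
    if "f \<in> points (dual_space X)" for f
    using dual_bound[OF X that z] that by (simp add: evaluation_def mult.commute)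
qed (simp add: evaluation_def)

text \<open>Finitely many conditions \<open>\<bar>f x\<bar> < \<epsilon>\<close> are merged into one on the sum, the form in which
  the harmonic series enters below.\<close>

lemma weak_neighbourhood_zero:
  assumes X: "normed_space X" and U: "openin (weak_topology X) U" "0 \<in> U"
  obtains F \<epsilon> where "finite F" "F \<subseteq> points (dual_space X)" "\<epsilon> > 0"
    "\<forall>x\<in>points X. (\<Sum>f\<in>F. \<bar>f x\<bar>) < \<epsilon> \<longrightarrow> x \<in> U"
proof -
  let ?S = "{{x \<in> points X. f x \<in> V} | f V. f \<in> points (dual_space X) \<and> open V}"
  have "generate_topology_on ?S U"
    using U(1) unfolding weak_topology_def by (rule openin_topology_generated_by)
  then have "0 \<in> U \<Longrightarrow> \<exists>F \<epsilon>. finite F \<and> F \<subseteq> points (dual_space X) \<and> \<epsilon> > 0 \<and>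
    (\<forall>x\<in>points X. (\<Sum>f\<in>F. \<bar>f x\<bar>) < \<epsilon> \<longrightarrow> x \<in> U)"
  proof induction
    case Empty
    then show ?case by simp
  next
    case (Int a b)
    from Int.IH(1) Int.prems obtain F \<epsilon> where F: "finite F" "F \<subseteq> points (dual_space X)" "\<epsilon> > 0"
      "\<forall>x\<in>points X. (\<Sum>f\<in>F. \<bar>f x\<bar>) < \<epsilon> \<longrightarrow> x \<in> a"
      by blast
    from Int.IH(2) Int.prems obtain G \<delta> where G: "finite G" "G \<subseteq> points (dual_space X)" "\<delta> > 0"
      "\<forall>x\<in>points X. (\<Sum>f\<in>G. \<bar>f x\<bar>) < \<delta> \<longrightarrow> x \<in> b"
      by blast
    have "(\<Sum>f\<in>F. \<bar>f x\<bar>) \<le> (\<Sum>f\<in>F \<union> G. \<bar>f x\<bar>)" "(\<Sum>f\<in>G. \<bar>f x\<bar>) \<le> (\<Sum>f\<in>F \<union> G. \<bar>f x\<bar>)" for x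
      using F(1) G(1) by (auto intro!: sum_mono2)
    then have "\<forall>x\<in>points X. (\<Sum>f\<in>F \<union> G. \<bar>f x\<bar>) < min \<epsilon> \<delta> \<longrightarrow> x \<in> a \<inter> b"
      using F(4) G(4) by (meson IntI le_less_trans min_less_iff_conj)
    then show ?case
      using F G by (intro exI[of _ "F \<union> G"] exI[of _ "min \<epsilon> \<delta>"]) auto
  next
    case (UN K)
    then show ?case by (meson Union_iff)
  next
    case (Basis s)
    then obtain f V where s: "s = {x \<in> points X. f x \<in> V}" and f: "f \<in> points (dual_space X)"
      and V: "open V"
      by blast
    have "0 \<in> V"
      using Basis.prems dual_zero[OF X f] by (simp add: s)
    then obtain e where e: "e > 0" "\<And>r. \<bar>r\<bar> < e \<Longrightarrow> r \<in> V"
      using V by (auto simp: open_dist dist_real_def)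
    then show ?case
      using f by (intro exI[of _ "{f}"] exI[of _ e]) (auto simp: s)
  qed
  then show thesis
    using U(2) that by blast
qed


section \<open>The Banach space of fourth-power summable sequences\<close>

definition l4 :: "(nat \<Rightarrow> real) nspace"
  where "l4 = \<lparr>points = {x. summable (\<lambda>n. x n ^ 4)}, nrm = (\<lambda>x. root 4 (\<Sum>n. x n ^ 4))\<rparr>"

lemma in_l4: "x \<in> points l4 \<longleftrightarrow> summable (\<lambda>n. x n ^ 4)"
  by (simp add: l4_def)

lemma nrm_l4_nonneg: "x \<in> points l4 \<Longrightarrow> 0 \<le> nrm l4 x"
  by (simp add: l4_def suminf_nonneg)

lemma nrm_l4_pow4: "x \<in> points l4 \<Longrightarrow> nrm l4 x ^ 4 = (\<Sum>n. x n ^ 4)"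
  by (simp add: l4_def suminf_nonneg)

lemma nrm_l4_leI:
  assumes "x \<in> points l4" "0 \<le> c" "(\<Sum>n. x n ^ 4) \<le> c ^ 4"
  shows "nrm l4 x \<le> c"
  using assms nrm_l4_pow4[OF assms(1)] by (metis power_mono_iff nrm_l4_nonneg zero_less_numeral)

lemma young4: "4 * \<bar>a ^ 3 * b\<bar> \<le> 3 * a ^ 4 + b ^ 4" for a b :: real
proof -
  have y: "4 * (a ^ 3 * b) \<le> 3 * a ^ 4 + b ^ 4" for a b :: real
  proof -
    \<comment> \<open>the difference of the two sides has the double root \<open>a = b\<close>\<close>
    have "0 \<le> (a - b)\<^sup>2 * (2 * a\<^sup>2 + (a + b)\<^sup>2)"
      by simp
    also have "\<dots> = 3 * a ^ 4 + b ^ 4 - 4 * (a ^ 3 * b)"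
      by (simp add: power2_eq_square power3_eq_cube power4_eq_xxxx algebra_simps)
    finally show ?thesis by simp
  qed
  show ?thesis
    using y[of a b] y[of a "-b"] by (simp add: abs_if)
qed

lemma convex4:
  fixes a b u v :: real
  assumes "u > 0" "v > 0"
  shows "(a + b) ^ 4 \<le> (u + v) ^ 3 * (a ^ 4 / u ^ 3 + b ^ 4 / v ^ 3)"
proof -
  let ?s = "u / (u + v)" and ?t = "v / (u + v)"
  have st: "?s + ?t = 1" "?s \<ge> 0" "?t \<ge> 0"
    using assms by (auto simp flip: add_divide_distrib)
  have "convex_on UNIV (\<lambda>x::real. x ^ 4)"
    by (rule convex_power_even) simp
  then have "(s * x + t * y) ^ 4 \<le> s * x ^ 4 + t * y ^ 4"
    if "s \<ge> 0" "t \<ge> 0" "s + t = 1" for s t x y :: real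
    using that by (simp add: convex_on_def)
  then have "(?s * (a / u) + ?t * (b / v)) ^ 4 \<le> ?s * (a / u) ^ 4 + ?t * (b / v) ^ 4"
    using st by blast
  also have "?s * (a / u) + ?t * (b / v) = (a + b) / (u + v)"
    using assms by (simp add: add_divide_distrib)
  finally have "(a + b) ^ 4 / (u + v) ^ 4 \<le> ?s * (a / u) ^ 4 + ?t * (b / v) ^ 4"
    by (simp add: power_divide)
  then have "(a + b) ^ 4 \<le> (u + v) ^ 4 * (?s * (a / u) ^ 4 + ?t * (b / v) ^ 4)"
    using assms by (simp add: pos_divide_le_eq mult.commute)
  also have "\<dots> = (u + v) ^ 3 * (a ^ 4 / u ^ 3 + b ^ 4 / v ^ 3)"
    using assms by (simp add: divide_simps) (simp add: eval_nat_numeral algebra_simps)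
  finally show ?thesis .
qed

lemma l4_add:
  assumes "x \<in> points l4" "y \<in> points l4"
  shows "x + y \<in> points l4"
proof -
  have "summable (\<lambda>n. 8 * (x n ^ 4 + y n ^ 4))"
    using assms unfolding in_l4 by (intro summable_mult summable_add)
  then have "summable (\<lambda>n. (x n + y n) ^ 4)"
    by (rule summable_comparison_test') (use convex4[of 1 1] in simp)
  then show ?thesis by (simp add: in_l4)
qed

text \<open>Termwise, this is convexity of the fourth power (\<open>convex4\<close>) applied to \<open>x\<close> and
  \<open>y\<close> divided by their norms.\<close>

lemma nrm_l4_triangle:
  assumes x: "x \<in> points l4" and y: "y \<in> points l4"
    and "nrm l4 x \<noteq> 0" "nrm l4 y \<noteq> 0"
  shows "nrm l4 (x + y) \<le> nrm l4 x + nrm l4 y"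
proof -
  define u v where "u = nrm l4 x" and "v = nrm l4 y"
  have uv: "u > 0" "v > 0"
    using assms nrm_l4_nonneg unfolding u_def v_def by force+
  have sx: "summable (\<lambda>n. x n ^ 4 / u ^ 3)" and sy: "summable (\<lambda>n. y n ^ 4 / v ^ 3)"
    using x y by (auto simp: in_l4 intro: summable_divide)
  have "(\<Sum>n. (x + y) n ^ 4) \<le> (\<Sum>n. (u + v) ^ 3 * (x n ^ 4 / u ^ 3 + y n ^ 4 / v ^ 3))"
    using l4_add[OF x y] convex4[OF uv] sx sy
    by (intro suminf_le summable_mult summable_add) (simp_all add: in_l4)
  also have "\<dots> = (u + v) ^ 3 * ((\<Sum>n. x n ^ 4) / u ^ 3 + (\<Sum>n. y n ^ 4) / v ^ 3)"
    using sx sy x y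
    by (simp add: suminf_mult suminf_add[symmetric] suminf_divide summable_add in_l4)
  also have "\<dots> = (u + v) ^ 4"
    using uv by (simp flip: nrm_l4_pow4[OF x] nrm_l4_pow4[OF y] u_def v_def)
      (simp add: eval_nat_numeral)
  finally show ?thesis
    using uv by (intro nrm_l4_leI l4_add x y) (simp_all add: u_def v_def)
qed

lemma nrm_l4_eq_0:
  assumes "x \<in> points l4"
  shows "nrm l4 x = 0 \<longleftrightarrow> x = 0"
proof -
  have "nrm l4 x = 0 \<longleftrightarrow> nrm l4 x ^ 4 = 0"
    by simp
  also have "\<dots> \<longleftrightarrow> (\<Sum>n. x n ^ 4) = 0"
    by (simp only: nrm_l4_pow4[OF assms])
  also have "\<dots> \<longleftrightarrow> (\<forall>n. x n ^ 4 = 0)"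
    using assms by (intro suminf_eq_zero_iff) (simp_all add: in_l4)
  finally show ?thesis
    by (simp add: fun_eq_iff)
qed

lemma normed_space_l4: "normed_space l4"
proof -
  have sc: "c *\<^sub>R x \<in> points l4" if "x \<in> points l4" for c x
    using that by (simp add: in_l4 power_mult_distrib summable_mult)
  have "subspace (points l4)"
    by (intro subspaceI l4_add sc) (simp_all add: in_l4)
  moreover have "nrm l4 (c *\<^sub>R x) = \<bar>c\<bar> * nrm l4 x" if x: "x \<in> points l4" for c x
  proof (rule power_eq_imp_eq_base[of _ 4])
    show "nrm l4 (c *\<^sub>R x) ^ 4 = (\<bar>c\<bar> * nrm l4 x) ^ 4"
      using x sc[OF x] by (simp add: nrm_l4_pow4 power_mult_distrib in_l4 suminf_mult)
  qed (use x sc[OF x] nrm_l4_nonneg in auto)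
  moreover have "nrm l4 (x + y) \<le> nrm l4 x + nrm l4 y"
    if "x \<in> points l4" "y \<in> points l4" for x y
    using that nrm_l4_triangle[OF that] nrm_l4_nonneg nrm_l4_eq_0
    by (cases "x = 0 \<or> y = 0") auto
  ultimately show ?thesis
    unfolding normed_space_def using nrm_l4_nonneg nrm_l4_eq_0 by blast
qed

lemmas l4_space = normed_spaceD[OF normed_space_l4]

lemma nrm_l4_partial:
  assumes "x \<in> points l4"
  shows "(\<Sum>n<N. x n ^ 4) \<le> nrm l4 x ^ 4"
  using assms by (simp add: nrm_l4_pow4 in_l4 sum_le_suminf)

lemma coordinate_le_nrm_l4:
  assumes "x \<in> points l4"
  shows "\<bar>x n\<bar> \<le> nrm l4 x"
proof -
  have "x n ^ 4 \<le> (\<Sum>k<Suc n. x k ^ 4)"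
    by (simp add: sum_nonneg)
  then have "\<bar>x n\<bar> ^ 4 \<le> nrm l4 x ^ 4"
    using nrm_l4_partial[OF assms, of "Suc n"] by simp
  then show ?thesis
    using nrm_l4_nonneg[OF assms] by (metis power_mono_iff abs_ge_zero zero_less_numeral)
qed

lemma l4_boundI:
  assumes c: "0 \<le> c" and le: "\<And>N. (\<Sum>n<N. x n ^ 4) \<le> c ^ 4"
  shows "x \<in> points l4" "nrm l4 x \<le> c"
proof -
  have *: "summable (\<lambda>n. x n ^ 4)"
    by (rule bounded_imp_summable[of _ "c ^ 4"])
      (simp_all add: le flip: lessThan_Suc_atMost del: sum.lessThan_Suc)
  then show "x \<in> points l4"
    by (simp add: in_l4)
  then show "nrm l4 x \<le> c"
    using le by (intro nrm_l4_leI c suminf_le_const *)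
qed

text \<open>The Cauchy estimate is passed to the coordinatewise limit on finite sections of the series,
  where it only involves finitely many coordinates.\<close>

lemma banach_space_l4: "banach_space l4"
proof -
  interpret Metric_space "points l4" "ndist l4"
    by (rule Metric_space_ndist[OF normed_space_l4])
  note diff = subspace_diff[OF l4_space(1)]
  have "\<exists>x. limitin mtopology \<sigma> x sequentially" if \<sigma>: "MCauchy \<sigma>" for \<sigma>
  proof -
    have p: "\<sigma> k \<in> points l4" for k
      using \<sigma> by (auto simp: MCauchy_def)
    have C: "\<exists>N. \<forall>m\<ge>N. \<forall>k\<ge>N. nrm l4 (\<sigma> m - \<sigma> k) < e" if "e > 0" for e
      using \<sigma> that p unfolding MCauchy_def ndist_def by simp
    have "Cauchy (\<lambda>k. \<sigma> k n)" for n
    proof (rule CauchyI)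
      fix e :: real assume "e > 0"
      then obtain N where N: "\<And>m k. m \<ge> N \<Longrightarrow> k \<ge> N \<Longrightarrow> nrm l4 (\<sigma> m - \<sigma> k) < e"
        using C by blast
      have "\<bar>\<sigma> m n - \<sigma> k n\<bar> < e" if "m \<ge> N" "k \<ge> N" for m k
        using N[OF that] coordinate_le_nrm_l4[OF diff[OF p p], of m k n] by simp
      then show "\<exists>N. \<forall>m\<ge>N. \<forall>k\<ge>N. norm (\<sigma> m n - \<sigma> k n) < e"
        by auto
    qed
    then have "\<forall>n. \<exists>l. (\<lambda>k. \<sigma> k n) \<longlonglongrightarrow> l"
      by (simp add: Cauchy_convergent_iff convergent_def)
    then obtain x where x: "\<And>n. (\<lambda>k. \<sigma> k n) \<longlonglongrightarrow> x n"
      by metis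
    have close: "\<exists>N. \<forall>m\<ge>N. \<sigma> m - x \<in> points l4 \<and> nrm l4 (\<sigma> m - x) \<le> e" if e: "e > 0" for e
    proof -
      obtain N where N: "\<And>m k. m \<ge> N \<Longrightarrow> k \<ge> N \<Longrightarrow> nrm l4 (\<sigma> m - \<sigma> k) < e"
        using C[OF e] by blast
      have "(\<Sum>n<M. (\<sigma> m - x) n ^ 4) \<le> e ^ 4" if m: "m \<ge> N" for m M
      proof (rule LIMSEQ_le_const2)
        show "(\<lambda>k. \<Sum>n<M. (\<sigma> m - \<sigma> k) n ^ 4) \<longlonglongrightarrow> (\<Sum>n<M. (\<sigma> m - x) n ^ 4)"
          by (auto intro!: tendsto_intros x)
        have "(\<Sum>n<M. (\<sigma> m - \<sigma> k) n ^ 4) \<le> e ^ 4" if "k \<ge> N" for k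
        proof -
          have "nrm l4 (\<sigma> m - \<sigma> k) ^ 4 \<le> e ^ 4"
            using N[OF m that] nrm_l4_nonneg[OF diff[OF p p]] by (intro power_mono) auto
          then show ?thesis
            using nrm_l4_partial[OF diff[OF p p], of m k M] by linarith
        qed
        then show "\<exists>N. \<forall>k\<ge>N. (\<Sum>n<M. (\<sigma> m - \<sigma> k) n ^ 4) \<le> e ^ 4"
          by blast
      qed
      then show ?thesis
        using l4_boundI[of e] e by (metis less_imp_le)
    qed
    obtain N where "\<sigma> N - x \<in> points l4"
      using close[of 1] by auto
    then have xp: "x \<in> points l4"
      using diff[OF p[of N]] by fastforce
    have "\<exists>N. \<forall>m\<ge>N. \<sigma> m \<in> points l4 \<and> ndist l4 (\<sigma> m) x < e" if "e > 0" for e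
    proof -
      obtain N where "\<And>m. m \<ge> N \<Longrightarrow> nrm l4 (\<sigma> m - x) \<le> e / 2"
        using close[of "e / 2"] \<open>e > 0\<close> by (meson half_gt_zero)
      then show ?thesis
        using that p xp by (intro exI[of _ N]) (force simp: ndist_def)
    qed
    then have "limitin mtopology \<sigma> x sequentially"
      using xp by (simp add: limit_metric_sequentially)
    then show ?thesis by blast
  qed
  then show ?thesis
    by (simp add: banach_space_def normed_space_l4 mcomplete_def)
qed


section \<open>Smoothness\<close>

definition support_functional :: "(nat \<Rightarrow> real) \<Rightarrow> (nat \<Rightarrow> real) \<Rightarrow> real"
  where "support_functional x y = (if y \<in> points l4 then \<Sum>n. x n ^ 3 * y n else 0)"

lemma summable_cube_mult:
  assumes "x \<in> points l4" "y \<in> points l4"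
  shows "summable (\<lambda>n. \<bar>x n ^ 3 * y n\<bar>)"
proof -
  have "summable (\<lambda>n. 3 * x n ^ 4 + y n ^ 4)"
    using assms unfolding in_l4 by (intro summable_mult summable_add)
  then show ?thesis
    by (rule summable_comparison_test') (use young4 in \<open>smt (verit) real_norm_def\<close>)
qed

text \<open>Hoelder's inequality for the exponents \<open>4/3\<close> and \<open>4\<close>: for \<open>y\<close> of norm one, Young's
  inequality bounds the sum by \<open>3/4 + 1/4\<close>, and the rest is scaling.\<close>

lemma support_functional_bound:
  assumes x: "x \<in> points l4" "nrm l4 x = 1" and y: "y \<in> points l4"
  shows "\<bar>\<Sum>n. x n ^ 3 * y n\<bar> \<le> nrm l4 y"
proof -
  have unit: "\<bar>\<Sum>n. x n ^ 3 * v n\<bar> \<le> 1" if v: "v \<in> points l4" "nrm l4 v = 1" for v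
  proof -
    have s: "summable (\<lambda>n. x n ^ 4)" "summable (\<lambda>n. v n ^ 4)"
      using x v by (simp_all add: in_l4)
    have "\<bar>\<Sum>n. x n ^ 3 * v n\<bar> \<le> (\<Sum>n. \<bar>x n ^ 3 * v n\<bar>)"
      by (rule summable_rabs[OF summable_cube_mult[OF x(1) v(1)]])
    also have "\<dots> \<le> (\<Sum>n. 3 / 4 * x n ^ 4 + 1 / 4 * v n ^ 4)"
    proof (rule suminf_le[OF _ summable_cube_mult[OF x(1) v(1)]])
      show "\<bar>x n ^ 3 * v n\<bar> \<le> 3 / 4 * x n ^ 4 + 1 / 4 * v n ^ 4" for n
        using young4[of "x n" "v n"] by simp
    qed (intro summable_add summable_mult s)
    also have "\<dots> = 3 / 4 * (\<Sum>n. x n ^ 4) + 1 / 4 * (\<Sum>n. v n ^ 4)"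
      by (simp only: suminf_add[symmetric] suminf_mult summable_mult s)
    also have "\<dots> = 1"
      by (simp add: x v flip: nrm_l4_pow4)
    finally show ?thesis .
  qed
  show ?thesis
  proof (cases "y = 0")
    case True
    then show ?thesis using nrm_l4_nonneg[OF y] by simp
  next
    case False
    define r where "r = nrm l4 y"
    have r: "r > 0"
      using False l4_space(2,3)[OF y] by (simp add: r_def less_le)
    let ?v = "inverse r *\<^sub>R y"
    have "\<bar>\<Sum>n. x n ^ 3 * ?v n\<bar> \<le> 1"
      using r by (intro unit[of ?v] subspace_scale[OF l4_space(1) y])
        (simp add: l4_space(4)[OF y] flip: r_def)
    also have "(\<Sum>n. x n ^ 3 * ?v n) = (\<Sum>n. inverse r * (x n ^ 3 * y n))"
      by (simp add: mult_ac)
    also have "\<dots> = inverse r * (\<Sum>n. x n ^ 3 * y n)"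
      by (rule suminf_mult[OF summable_rabs_cancel[OF summable_cube_mult[OF x(1) y]]])
    finally show ?thesis
      using r by (simp add: abs_mult field_simps flip: r_def)
  qed
qed

lemma support_functional_in_dual:
  assumes x: "x \<in> points l4" "nrm l4 x = 1"
  shows "support_functional x \<in> points (dual_space l4)"
proof (rule dual_spaceI[where C = 1])
  note s = summable_rabs_cancel[OF summable_cube_mult[OF x(1)]]
  show "support_functional x (y + w) = support_functional x y + support_functional x w"
    if "y \<in> points l4" "w \<in> points l4" for y w
    using that l4_add[OF that] by (simp add: support_functional_def distrib_left suminf_add s)
  show "support_functional x (c *\<^sub>R y) = c * support_functional x y" if "y \<in> points l4" for c y
    using that subspace_scale[OF l4_space(1) that] suminf_mult[OF s[OF that], of c]
    by (simp add: support_functional_def mult_ac)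
qed (use support_functional_bound[OF x] in \<open>auto simp: support_functional_def\<close>)

lemma support_functional_self:
  assumes "x \<in> points l4" "nrm l4 x = 1"
  shows "support_functional x x = 1"
  using assms nrm_l4_pow4[of x] by (simp add: support_functional_def eval_nat_numeral mult_ac)

text \<open>The line \<open>t \<mapsto> x + t *\<^sub>R y\<close> turns the bound \<open>(f v)^4 \<le> \<Sum>n. v n ^ 4\<close> into an inequality of
  quartic polynomials with equality at \<open>t = 0\<close>, so their derivatives agree there.\<close>

lemma l4_support_unique:
  assumes x: "x \<in> points l4" "nrm l4 x = 1"
    and f: "f \<in> points (dual_space l4)" "nrm (dual_space l4) f = 1" "f x = 1"
  shows "f = support_functional x"
proof
  fix y
  show "f y = support_functional x y"
  proof (cases "y \<in> points l4")
    case False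
    then show ?thesis
      using dual_spaceD(3)[OF f(1)] by (simp add: support_functional_def)
  next
    case y: True
    define p where "p = f y"
    define A where "A = (\<Sum>n. x n ^ 3 * y n)"
    define B where "B = (\<Sum>n. x n ^ 2 * y n ^ 2)"
    define C where "C = (\<Sum>n. y n ^ 3 * x n)"
    define D where "D = (\<Sum>n. y n ^ 4)"
    have sx: "summable (\<lambda>n. x n ^ 4)" and sy: "summable (\<lambda>n. y n ^ 4)"
      using x y by (simp_all add: in_l4)
    have sA: "summable (\<lambda>n. x n ^ 3 * y n)" and sC: "summable (\<lambda>n. y n ^ 3 * x n)"
      using summable_cube_mult x y by (auto intro: summable_rabs_cancel)
    have sB: "summable (\<lambda>n. x n ^ 2 * y n ^ 2)"
    proof (rule summable_comparison_test'[OF summable_add[OF sx sy]])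
      fix n
      have "0 \<le> (x n ^ 2 - y n ^ 2)\<^sup>2 + x n ^ 4 + y n ^ 4"
        by simp
      also have "\<dots> = 2 * (x n ^ 4 + y n ^ 4 - x n ^ 2 * y n ^ 2)"
        by (simp add: eval_nat_numeral algebra_simps)
      finally show "norm (x n ^ 2 * y n ^ 2) \<le> x n ^ 4 + y n ^ 4"
        by simp
    qed
    have ineq: "(1 + t * p) ^ 4 \<le> 1 + 4 * t * A + 6 * t ^ 2 * B + 4 * t ^ 3 * C + t ^ 4 * D" for t
    proof -
      let ?v = "x + t *\<^sub>R y"
      have ty: "t *\<^sub>R y \<in> points l4" and v: "?v \<in> points l4"
        using l4_add x(1) subspace_scale[OF l4_space(1) y] by blast+
      have "f ?v = 1 + t * p"
        using dual_spaceD(1)[OF f(1) x(1) ty] dual_spaceD(2)[OF f(1) y] f(3) by (simp add: p_def)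
      then have "\<bar>1 + t * p\<bar> \<le> nrm l4 ?v"
        using dual_bound[OF normed_space_l4 f(1) v] f(2) by simp
      then have "\<bar>1 + t * p\<bar> ^ 4 \<le> nrm l4 ?v ^ 4"
        by (intro power_mono) auto
      then have "(1 + t * p) ^ 4 \<le> (\<Sum>n. ?v n ^ 4)"
        by (simp add: nrm_l4_pow4[OF v])
      also have "(\<lambda>n. ?v n ^ 4) = (\<lambda>n. x n ^ 4 + 4 * t * (x n ^ 3 * y n)
          + 6 * t ^ 2 * (x n ^ 2 * y n ^ 2) + 4 * t ^ 3 * (y n ^ 3 * x n) + t ^ 4 * y n ^ 4)"
        by (rule ext) (simp add: eval_nat_numeral algebra_simps)
      also have "(\<Sum>n. x n ^ 4 + 4 * t * (x n ^ 3 * y n) + 6 * t ^ 2 * (x n ^ 2 * y n ^ 2)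
          + 4 * t ^ 3 * (y n ^ 3 * x n) + t ^ 4 * y n ^ 4)
          = (\<Sum>n. x n ^ 4) + 4 * t * A + 6 * t ^ 2 * B + 4 * t ^ 3 * C + t ^ 4 * D"
        unfolding A_def B_def C_def D_def
        by (simp only: suminf_add[symmetric] suminf_mult summable_add summable_mult
            sx sy sA sB sC)
      finally show ?thesis
        by (simp add: x flip: nrm_l4_pow4[OF x(1)])
    qed
    define h where "h t = 1 + 4 * t * A + 6 * t ^ 2 * B + 4 * t ^ 3 * C + t ^ 4 * D
      - (1 + t * p) ^ 4" for t
    have "(h has_real_derivative 4 * (A - p)) (at 0)"
      unfolding h_def by (auto intro!: derivative_eq_intros)
    moreover have "\<forall>t. \<bar>0 - t\<bar> < 1 \<longrightarrow> h 0 \<le> h t"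
      using ineq by (auto simp: h_def)
    ultimately have "4 * (A - p) = 0"
      by (rule DERIV_local_min[OF _ zero_less_one])
    then show ?thesis
      by (simp add: y p_def A_def support_functional_def)
  qed
qed

lemma smooth_space_l4: "smooth_space l4"
  unfolding smooth_space_def smooth_point_def
proof (intro ballI conjI)
  fix x assume xs: "x \<in> unit_sphere l4"
  then have x: "x \<in> points l4" "nrm l4 x = 1"
    by (auto simp: unit_sphere_def)
  have "x \<noteq> 0"
    using l4_space(3)[OF x(1)] x(2) by auto
  then have "nrm (dual_space l4) (support_functional x) = 1"
    using support_functional_bound[OF x] support_functional_self[OF x] x
    by (intro dual_norm_eqI[OF normed_space_l4 support_functional_in_dual[OF x], of _ x])
      (auto simp: support_functional_def)
  then show "\<exists>!f. f \<in> unit_sphere (dual_space l4) \<and> f x = 1"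
    using support_functional_in_dual[OF x] support_functional_self[OF x] l4_support_unique[OF x]
    unfolding unit_sphere_def by blast
qed


section \<open>The dual map along the unit vectors\<close>

definition unit_vec :: "nat \<Rightarrow> nat \<Rightarrow> real"
  where "unit_vec n k = (if k = n then 1 else 0)"

lemma unit_vec_l4: "unit_vec n \<in> points l4"
proof -
  have "summable (\<lambda>k. unit_vec n k ^ 4)"
    by (rule summable_finite[of "{n}"]) (auto simp: unit_vec_def)
  then show ?thesis
    by (simp add: in_l4)
qed

lemma nrm_unit_vec: "nrm l4 (unit_vec n) = 1"
proof -
  have "(\<Sum>k. unit_vec n k ^ 4) = (\<Sum>k\<in>{n}. unit_vec n k ^ 4)"
    by (rule suminf_finite) (auto simp: unit_vec_def)
  then show ?thesis
    by (simp add: l4_def unit_vec_def)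
qed

lemma dual_map_unit_vec:
  assumes z: "z \<in> points l4"
  shows "dual_map l4 (t *\<^sub>R unit_vec n) z = t * z n"
proof (cases "t = 0")
  case True
  have 0: "(0 :: nat \<Rightarrow> real) \<in> points l4"
    using subspace_0[OF l4_space(1)] .
  note J = dual_map[OF normed_space_l4 smooth_space_l4 0]
  have "nrm l4 0 = 0"
    using l4_space(3)[OF 0] by simp
  then show ?thesis
    using True J(2) dual_bound[OF normed_space_l4 J(1) z] by simp
next
  case False
  define g where "g y = (if y \<in> points l4 then t * y n else 0)" for y
  note sub = l4_space(1)
  have e: "t *\<^sub>R unit_vec n \<in> points l4" "nrm l4 (t *\<^sub>R unit_vec n) = \<bar>t\<bar>"
    using subspace_scale[OF sub unit_vec_l4] l4_space(4)[OF unit_vec_l4, of t n]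
    by (simp_all add: nrm_unit_vec)
  have bound: "\<bar>g y\<bar> \<le> \<bar>t\<bar> * nrm l4 y" if "y \<in> points l4" for y
    using coordinate_le_nrm_l4[OF that, of n] that by (simp add: g_def abs_mult mult_left_mono)
  have g: "g \<in> points (dual_space l4)"
  proof (rule dual_spaceI[OF _ _ bound])
    show "g (x + y) = g x + g y" if "x \<in> points l4" "y \<in> points l4" for x y
      using that l4_add[OF that] by (simp add: g_def distrib_left)
    show "g (c *\<^sub>R x) = c * g x" if "x \<in> points l4" for c x
      using that subspace_scale[OF sub that] by (simp add: g_def)
  qed (simp_all add: g_def)
  have ge: "g (t *\<^sub>R unit_vec n) = t\<^sup>2"
    using e(1) by (simp add: g_def unit_vec_def power2_eq_square)
  have "t *\<^sub>R unit_vec n \<noteq> 0"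
    using l4_space(3)[OF e(1)] e(2) False by simp
  then have "nrm (dual_space l4) g = \<bar>t\<bar>"
    using e ge by (intro dual_norm_eqI[OF normed_space_l4 g bound, of "t *\<^sub>R unit_vec n"])
      (simp_all add: power2_eq_square abs_mult)
  then have "dual_map l4 (t *\<^sub>R unit_vec n) = g"
    using e g ge by (intro dual_map_unique[OF normed_space_l4 smooth_space_l4]) simp_all
  then show ?thesis
    using z by (simp add: g_def)
qed


section \<open>Weak discontinuity at zero\<close>

lemma dual_finite_support:
  assumes f: "f \<in> points (dual_space l4)"
  shows "(\<lambda>k. if k < N then c k else 0) \<in> points l4 \<and>
    f (\<lambda>k. if k < N then c k else 0) = (\<Sum>n<N. c n * f (unit_vec n))"
proof (induction N)
  case 0
  show ?case
    using dual_zero[OF normed_space_l4 f] by (simp add: in_l4 zero_fun_def)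
next
  case (Suc N)
  have ce: "c N *\<^sub>R unit_vec N \<in> points l4"
    by (rule subspace_scale[OF l4_space(1) unit_vec_l4])
  have "(\<lambda>k. if k < Suc N then c k else 0) = (\<lambda>k. if k < N then c k else 0) + c N *\<^sub>R unit_vec N"
    by (auto simp: fun_eq_iff unit_vec_def less_Suc_eq)
  then show ?case
    using Suc l4_add[OF _ ce] dual_spaceD(1)[OF f _ ce] dual_spaceD(2)[OF f unit_vec_l4] by simp
qed

text \<open>One half of the duality between \<open>\<ell>\<^sub>4\<close> and \<open>\<ell>\<^bsub>4/3\<^esub>\<close>: the signs of the coefficients of \<open>f\<close>
  can be absorbed into the vector that \<open>f\<close> is applied to.\<close>

lemma dual_coefficients_sum:
  assumes f: "f \<in> points (dual_space l4)" and z: "z \<in> points l4"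
  shows "(\<Sum>n<N. \<bar>z n\<bar> * \<bar>f (unit_vec n)\<bar>) \<le> nrm (dual_space l4) f * nrm l4 z"
proof -
  define w where "w = (\<lambda>k. if k < N then \<bar>z k\<bar> * sgn (f (unit_vec k)) else 0)"
  have s: "sgn r * r = \<bar>r\<bar>" for r :: real
    by (simp add: abs_sgn mult.commute)
  have w: "w \<in> points l4" "f w = (\<Sum>n<N. \<bar>z n\<bar> * \<bar>f (unit_vec n)\<bar>)"
    using dual_finite_support[OF f, of N "\<lambda>k. \<bar>z k\<bar> * sgn (f (unit_vec k))"]
    by (simp_all add: w_def mult.assoc s)
  have "\<bar>w k\<bar> ^ 4 \<le> \<bar>z k\<bar> ^ 4" for k
    by (intro power_mono) (simp_all add: w_def abs_mult abs_sgn_eq)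
  then have "(\<Sum>k. w k ^ 4) \<le> (\<Sum>k. z k ^ 4)"
    using w(1) z by (intro suminf_le) (simp_all add: in_l4)
  then have le: "nrm l4 w \<le> nrm l4 z"
    using nrm_l4_nonneg[OF z] by (intro nrm_l4_leI w) (simp_all add: nrm_l4_pow4[OF z])
  have "0 \<le> nrm (dual_space l4) f"
    using normed_spaceD(2)[OF normed_space_dual[OF normed_space_l4] f] .
  then show ?thesis
    using dual_bound[OF normed_space_l4 f w(1)] mult_left_mono[OF le] w(2) by fastforce
qed

definition inv_sqrt_seq :: "nat \<Rightarrow> real"
  where "inv_sqrt_seq n = 1 / sqrt (real (Suc n))"

lemma inv_sqrt_seq_l4: "inv_sqrt_seq \<in> points l4"
proof -
  have "summable (\<lambda>n. inverse (real n ^ 2))"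
    by (rule inverse_power_summable) simp
  then have "summable (\<lambda>n. inverse (real (Suc n) ^ 2))"
    by (subst summable_Suc_iff)
  moreover have "inv_sqrt_seq n ^ 4 = inverse (real (Suc n) ^ 2)" for n
    using power_mult[of "sqrt (real (Suc n))" 2 2]
    by (simp add: inv_sqrt_seq_def power_divide inverse_eq_divide del: of_nat_Suc)
  ultimately show ?thesis
    by (simp add: in_l4)
qed

text \<open>Otherwise \<open>dual_coefficients_sum\<close> for \<open>inv_sqrt_seq\<close> would bound the partial sums of
  \<open>\<epsilon> * (inv_sqrt_seq n)\<^sup>2\<close>, a multiple of the harmonic series.\<close>

lemma dual_coefficients_below:
  assumes F: "F \<subseteq> points (dual_space l4)" and \<epsilon>: "\<epsilon> > 0"
  shows "\<exists>n. (\<Sum>f\<in>F. \<bar>f (unit_vec n)\<bar>) < \<epsilon> * inv_sqrt_seq n"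
proof (rule ccontr)
  let ?z = inv_sqrt_seq
  assume "\<not> ?thesis"
  then have ge: "\<epsilon> * ?z n \<le> (\<Sum>f\<in>F. \<bar>f (unit_vec n)\<bar>)" for n
    by (simp add: not_less)
  have z: "?z n \<ge> 0" for n
    by (simp add: inv_sqrt_seq_def)
  define M where "M = (\<Sum>f\<in>F. nrm (dual_space l4) f * nrm l4 ?z)"
  have "(\<Sum>n<N. \<epsilon> * inverse (real (Suc n))) \<le> M" for N
  proof -
    have "(\<Sum>n<N. \<epsilon> * inverse (real (Suc n))) = (\<Sum>n<N. ?z n * (\<epsilon> * ?z n))"
      by (simp add: inv_sqrt_seq_def field_simps)
    also have "\<dots> \<le> (\<Sum>n<N. ?z n * (\<Sum>f\<in>F. \<bar>f (unit_vec n)\<bar>))"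
      by (intro sum_mono mult_left_mono ge z)
    also have "\<dots> = (\<Sum>f\<in>F. \<Sum>n<N. \<bar>?z n\<bar> * \<bar>f (unit_vec n)\<bar>)"
      by (subst sum.swap) (simp add: sum_distrib_left z)
    also have "\<dots> \<le> M"
      unfolding M_def using F by (intro sum_mono dual_coefficients_sum inv_sqrt_seq_l4) auto
    finally show ?thesis .
  qed
  then have "summable (\<lambda>n. \<epsilon> * inverse (real (Suc n)))"
    using \<epsilon> by (intro bounded_imp_summable[of _ M])
      (simp_all flip: lessThan_Suc_atMost del: sum.lessThan_Suc of_nat_Suc)
  then have "summable (\<lambda>n. inverse (real (Suc n)))"
    using \<epsilon> summable_mult[of _ "inverse \<epsilon>"] by (force simp flip: mult.assoc)
  then have "summable (\<lambda>n. inverse (real n))"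
    by (subst (asm) summable_Suc_iff)
  then show False
    using not_summable_harmonic by blast
qed

theorem mainTheorem4:
  shows "\<exists>X :: (nat \<Rightarrow> real) nspace. banach_space X \<and> smooth_space X \<and>
    \<not> topcontinuous_at (weak_topology X) (weak_topology (dual_space X)) (dual_map X) 0"
proof (intro exI[of _ l4] conjI banach_space_l4 smooth_space_l4 notI)
  let ?z = inv_sqrt_seq and ?D = "dual_space l4"
  assume tc: "topcontinuous_at (weak_topology l4) (weak_topology ?D) (dual_map l4) 0"
  have cont: "\<exists>U. openin (weak_topology l4) U \<and> 0 \<in> U \<and> (\<forall>y\<in>U. dual_map l4 y \<in> V)"
    if "openin (weak_topology ?D) V" "dual_map l4 0 \<in> V" for V
    using tc[unfolded topcontinuous_at_def, THEN conjunct2, THEN conjunct2, rule_format] that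
    by simp
  note J = dual_map(1)[OF normed_space_l4 smooth_space_l4]
  define V where "V = {g \<in> points ?D. evaluation l4 ?z g \<in> {..<1}}"
  have "openin (weak_topology ?D) V"
    unfolding weak_topology_def V_def
    using evaluation_in_bidual[OF normed_space_l4 inv_sqrt_seq_l4]
    by (intro topology_generated_by_Basis CollectI exI[of _ "evaluation l4 ?z"] exI[of _ "{..<1}"])
      simp
  moreover have "dual_map l4 0 \<in> V"
    using J[OF subspace_0[OF l4_space(1)]] dual_map_unit_vec[OF inv_sqrt_seq_l4, of 0 0]
    by (simp add: V_def evaluation_def)
  ultimately have "\<exists>U. openin (weak_topology l4) U \<and> 0 \<in> U \<and> (\<forall>y\<in>U. dual_map l4 y \<in> V)"
    by (rule cont)
  then obtain U where U: "openin (weak_topology l4) U" "0 \<in> U"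
    and UV: "\<forall>y\<in>U. dual_map l4 y \<in> V"
    by (elim exE conjE)
  obtain F \<epsilon> where "finite F" and F: "F \<subseteq> points ?D" "\<epsilon> > 0"
    and FU: "\<forall>x\<in>points l4. (\<Sum>f\<in>F. \<bar>f x\<bar>) < \<epsilon> \<longrightarrow> x \<in> U"
    by (rule weak_neighbourhood_zero[OF normed_space_l4 U])
  obtain n where n: "(\<Sum>f\<in>F. \<bar>f (unit_vec n)\<bar>) < \<epsilon> / 2 * ?z n"
    using dual_coefficients_below[OF F(1), of "\<epsilon> / 2"] F(2) by auto
  have zn: "?z n > 0"
    by (simp add: inv_sqrt_seq_def)
  \<comment> \<open>scaled so that its image under the dual map takes the value \<open>2 > 1\<close> at \<open>?z\<close>\<close>
  let ?x = "(2 / ?z n) *\<^sub>R unit_vec n"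
  have "\<bar>f ?x\<bar> = 2 / ?z n * \<bar>f (unit_vec n)\<bar>" if "f \<in> F" for f
    using dual_spaceD(2)[OF subsetD[OF F(1) that] unit_vec_l4] zn by (simp add: abs_mult)
  then have "(\<Sum>f\<in>F. \<bar>f ?x\<bar>) = 2 / ?z n * (\<Sum>f\<in>F. \<bar>f (unit_vec n)\<bar>)"
    by (simp add: sum_distrib_left)
  also have "\<dots> < \<epsilon>"
    using n zn by (simp add: field_simps)
  finally have "dual_map l4 ?x \<in> V"
    by (intro UV[rule_format] FU[rule_format] subspace_scale[OF l4_space(1) unit_vec_l4])
  moreover have "dual_map l4 ?x ?z = 2"
    using zn by (simp add: dual_map_unit_vec[OF inv_sqrt_seq_l4])
  ultimately show False
    by (auto simp: V_def evaluation_def)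
qed

end
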